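(* Let $d \ge 1$ be an integer and let $(X_n)_{n\ge 0}$ and $(Y_n)_{n\ge 0}$ be two independent simple discrete-time random walks on $\mathbb{Z}^d$ started at the same vertex, $X_0 = Y_0$. Then the expected number of collisions $$\mathbb{E}\bigl[\#\{n \ge 0 : X_n = Y_n\}\bigr]$$ is infinite if $d \le 2$ and finite if $d > 2$.
   Context: A simple discrete-time random walk on $\mathbb{Z}^d$ is a Markov chain $(X_n)_{n\ge 0}$ with values in $\mathbb{Z}^d$ that at each step moves uniformly to one of the $2d$ nearest neighbours: $\mathbb{P}(X_{n+1}=y \mid X_n = x) = \frac{1}{2d}$ if $\|x-y\| = 1$ (Euclidean norm), and $0$ otherwise. Two walks are independent if the processes $(X_n)_{n \ge 0}$ and $(Y_n)_{n \ge 0}$ are independent. A collision is a time $n$ at which $X_n = Y_n$. *)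

theory Defs
  imports "HOL-Probability.Probability"
begin

definition lattice_dist :: "int ^ 'd \<Rightarrow> int ^ 'd \<Rightarrow> real" where
  "lattice_dist x y = norm ((\<chi> i. real_of_int (x $ i - y $ i)) :: real ^ 'd)"

definition srw_kernel :: "int ^ 'd \<Rightarrow> int ^ 'd \<Rightarrow> real" where
  "srw_kernel x y = (if lattice_dist x y = 1 then 1 / (2 * real CARD('d)) else 0)"

text \<open>
  The condition combines the Markov property and the transition probabilities: given any history
  \<open>x 0, \<dots>, x n\<close> of positive probability, the next state has law \<open>p (x n)\<close>. The initial law is
  unrestricted. Only the values of \<open>x\<close> up to \<open>n\<close> matter.
\<close>
definition markov_chain :: "'a measure \<Rightarrow> ('s \<Rightarrow> 's \<Rightarrow> real) \<Rightarrow> (nat \<Rightarrow> 'a \<Rightarrow> 's) \<Rightarrow> bool" where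
  "markov_chain M p X \<longleftrightarrow>
     (\<forall>n. X n \<in> measurable M (count_space UNIV)) \<and>
     (\<forall>n x y. \<P>(\<omega> in M. \<forall>k\<le>n. X k \<omega> = x k) > 0 \<longrightarrow>
        \<P>(\<omega> in M. X (Suc n) \<omega> = y \<bar> \<forall>k\<le>n. X k \<omega> = x k) = p (x n) y)"

definition simple_random_walk :: "'a measure \<Rightarrow> (nat \<Rightarrow> 'a \<Rightarrow> int ^ 'd) \<Rightarrow> bool" where
  "simple_random_walk M X \<longleftrightarrow> markov_chain M srw_kernel X"

definition indep_processes ::
    "'a measure \<Rightarrow> (nat \<Rightarrow> 'a \<Rightarrow> 's) \<Rightarrow> (nat \<Rightarrow> 'a \<Rightarrow> 's) \<Rightarrow> bool" where
  "indep_processes M X Y \<longleftrightarrow>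
     prob_space.indep_var M
       (PiM UNIV (\<lambda>_::nat. count_space UNIV)) (\<lambda>\<omega> n. X n \<omega>)
       (PiM UNIV (\<lambda>_::nat. count_space UNIV)) (\<lambda>\<omega> n. Y n \<omega>)"

text \<open>Counting measure is used because \<open>card\<close> would give 0 for infinitely many collisions.\<close>
definition num_collisions :: "(nat \<Rightarrow> 'a \<Rightarrow> 's) \<Rightarrow> (nat \<Rightarrow> 'a \<Rightarrow> 's) \<Rightarrow> 'a \<Rightarrow> ennreal" where
  "num_collisions X Y \<omega> = emeasure (count_space UNIV) {n. X n \<omega> = Y n \<omega>}"

end

theory Submission
  imports Defs
begin

text \<open>
  Independence and a common starting vertex give both walks the same law \<open>p n\<close> at time \<open>n\<close>, and
  \<open>P(X n = Y n) = (\<Sum>x. (p n x)\<^sup>2)\<close>, written \<open>u n\<close> here. By monotone convergence the expected number of collisions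
  is the sum of the \<open>u n\<close>, so the question is how fast the energy \<open>u n\<close> of the law decays. Both answers
  come from elementary \<open>\<ell>\<^sup>2\<close> estimates, without Fourier analysis or a local limit theorem.

  Divergence for \<open>d \<le> 2\<close>. The mean squared distance from the starting point at time \<open>n\<close> is \<open>n\<close>
  (\<open>walk_second_moment\<close>), so at least half of the mass lies in a box with \<open>O(n)\<close> points. The Cauchy--Schwarz
  inequality gives \<open>u n \<ge> c / n\<close> (\<open>walk_autocorr_0_lower_bound\<close>), and the harmonic series diverges.

  Convergence for \<open>d > 2\<close>. The argument is that of Nash. Comparing \<open>p n\<close> with its average over a
  box of side \<open>R\<close> spanned by three coordinate directions bounds \<open>u n\<close> by \<open>1 / R\<^sup>3\<close> plus \<open>R\<^sup>2\<close> times the squared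
  distance of \<open>p n\<close> from its translates by doubled unit steps (\<open>card_box_autocorr_0_le\<close>). That distance is
  in turn bounded by the energy \<open>u n - u (n + 1)\<close> lost in one step (\<open>autocorr_0_decrease\<close>), so
  \<open>u n \<le> 1 / R\<^sup>3 + C R\<^sup>2 (u n - u (n + 1))\<close> for every \<open>R\<close>. The best \<open>R\<close> turns this into
  \<open>u n \<le> C' (root 3 (u n) - root 3 (u (n + 1)))\<close> (\<open>le_cube_root_decrement\<close>), which telescopes.
\<close>

section \<open>Autocorrelation of a mass function\<close>

definition autocorr :: "('g::ab_group_add \<Rightarrow> real) \<Rightarrow> 'g \<Rightarrow> real" where
  "autocorr f w = (\<Sum>\<^sub>\<infinity>x. f x * f (x + w))"

definition mass_function :: "('g \<Rightarrow> real) \<Rightarrow> bool" where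
  "mass_function f \<longleftrightarrow> (\<forall>x. 0 \<le> f x) \<and> (f has_sum 1) UNIV"

text \<open>
  Translation invariance of sums over the whole group; every identity for autocorrelations below
  rests on it.
\<close>
lemma has_sum_translate:
  fixes f :: "'g::ab_group_add \<Rightarrow> real"
  shows "((\<lambda>x. f (x + a)) has_sum s) UNIV \<longleftrightarrow> (f has_sum s) UNIV"
  by (rule has_sum_reindex_bij_betw) (rule bij_plus_right)

lemma has_sum_finite_sum:
  fixes f :: "'i \<Rightarrow> 'b \<Rightarrow> real"
  assumes "\<And>i. i \<in> I \<Longrightarrow> (f i has_sum s i) A"
  shows "((\<lambda>x. \<Sum>i\<in>I. f i x) has_sum (\<Sum>i\<in>I. s i)) A"
  using assms by (induction I rule: infinite_finite_induct) (auto intro!: has_sum_add)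

lemma mass_function_nonneg: "mass_function f \<Longrightarrow> 0 \<le> f x"
  by (simp add: mass_function_def)

lemma mass_function_sum_le_1:
  assumes "mass_function f" "finite A"
  shows "sum f A \<le> 1"
  using assms by (intro finite_sum_le_has_sum[where S = 1 and A = UNIV]) (auto simp: mass_function_def)

lemma mass_function_le_1: "mass_function f \<Longrightarrow> f x \<le> 1"
  using mass_function_sum_le_1[of f "{x}"] by simp

lemma autocorr_has_sum:
  assumes "mass_function f"
  shows "((\<lambda>x. f (x + a) * f (x + b)) has_sum autocorr f (b - a)) UNIV"
proof -
  have "(\<lambda>x. f x * f (x + (b - a))) summable_on UNIV"
  proof (rule summable_on_comparison_test)
    show "f summable_on UNIV"
      using assms by (auto simp: mass_function_def summable_on_def)
    show "f x * f (x + (b - a)) \<le> f x" for x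
      using mass_function_le_1[OF assms] mass_function_nonneg[OF assms]
      by (simp add: mult_left_le)
  qed (use mass_function_nonneg[OF assms] in auto)
  then have "((\<lambda>x. f x * f (x + (b - a))) has_sum autocorr f (b - a)) UNIV"
    unfolding autocorr_def by (rule has_sum_infsum)
  then have "((\<lambda>x. f (x + a) * f (x + a + (b - a))) has_sum autocorr f (b - a)) UNIV"
    by (subst has_sum_translate[where f = "\<lambda>x. f x * f (x + (b - a))"])
  then show ?thesis
    by (simp add: algebra_simps)
qed

text \<open>
  Half the squared \<open>\<ell>\<^sup>2\<close> distance between \<open>f\<close> and its translate by \<open>w\<close>.
\<close>
definition defect :: "('g::ab_group_add \<Rightarrow> real) \<Rightarrow> 'g \<Rightarrow> real" where
  "defect f w = autocorr f 0 - autocorr f w"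

lemma defect_has_sum:
  assumes "mass_function f"
  shows "((\<lambda>x. (f (x + a) - f (x + b))\<^sup>2) has_sum 2 * defect f (b - a)) UNIV"
proof -
  have "((\<lambda>x. f (x + a) * f (x + a) + f (x + b) * f (x + b) + (-2) * (f (x + a) * f (x + b)))
      has_sum (autocorr f (a - a) + autocorr f (b - b) + (-2) * autocorr f (b - a))) UNIV"
    by (intro has_sum_add has_sum_cmult_right autocorr_has_sum assms)
  then show ?thesis
    by (simp add: power2_eq_square algebra_simps defect_def)
qed

lemma defect_nonneg:
  assumes "mass_function f"
  shows "0 \<le> defect f w"
  using has_sum_nonneg[OF defect_has_sum[OF assms, of 0 w]] by simp

lemma weighted_square_sum_le:
  fixes a b t :: real
  assumes "t > 0"
  shows "(a + b)\<^sup>2 \<le> (1 + 1 / t) * a\<^sup>2 + (1 + t) * b\<^sup>2"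
proof -
  have "0 \<le> (a - t * b)\<^sup>2 / t"
    using assms by simp
  then show ?thesis
    using assms by (simp add: field_simps power2_eq_square)
qed

text \<open>
  The squared triangle inequality \<open>\<parallel>f - \<tau>\<^sub>v\<^sub>+\<^sub>w f\<parallel>\<^sup>2 \<le> (\<parallel>f - \<tau>\<^sub>v f\<parallel> + \<parallel>\<tau>\<^sub>v f - \<tau>\<^sub>v\<^sub>+\<^sub>w f\<parallel>)\<^sup>2\<close>, with the
  cross term split by a free parameter \<open>t\<close>. This avoids square roots, and choosing \<open>t\<close> later loses nothing.
\<close>
lemma defect_add_le:
  assumes "mass_function f" "t > 0"
  shows "defect f (v + w) \<le> (1 + 1 / t) * defect f v + (1 + t) * defect f w"
proof -
  have "2 * defect f (v + w - 0) \<le> (1 + 1 / t) * (2 * defect f (v - 0)) + (1 + t) * (2 * defect f (v + w - v))"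
  proof (rule has_sum_mono)
    show "((\<lambda>x. (f (x + 0) - f (x + (v + w)))\<^sup>2) has_sum 2 * defect f (v + w - 0)) UNIV"
      by (rule defect_has_sum[OF assms(1)])
    show "((\<lambda>x. (1 + 1 / t) * (f (x + 0) - f (x + v))\<^sup>2 + (1 + t) * (f (x + v) - f (x + (v + w)))\<^sup>2)
        has_sum (1 + 1 / t) * (2 * defect f (v - 0)) + (1 + t) * (2 * defect f (v + w - v))) UNIV"
      by (intro has_sum_add has_sum_cmult_right defect_has_sum assms)
    show "(f (x + 0) - f (x + (v + w)))\<^sup>2
      \<le> (1 + 1 / t) * (f (x + 0) - f (x + v))\<^sup>2 + (1 + t) * (f (x + v) - f (x + (v + w)))\<^sup>2" for x
      using weighted_square_sum_le[OF assms(2), of "f (x + 0) - f (x + v)" "f (x + v) - f (x + (v + w))"]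
      by simp
  qed
  then have "2 * defect f (v + w) \<le> 2 * ((1 + 1 / t) * defect f v + (1 + t) * defect f w)"
    by (simp add: algebra_simps)
  then show ?thesis by simp
qed

primrec nat_multiple :: "nat \<Rightarrow> 'g::ab_group_add \<Rightarrow> 'g" where
  "nat_multiple 0 e = 0"
| "nat_multiple (Suc k) e = nat_multiple k e + e"

text \<open>
  A distance grows at most linearly along multiples of \<open>e\<close>, so its square grows at most quadratically.
\<close>
lemma defect_nat_multiple_le:
  assumes "mass_function f"
  shows "defect f (nat_multiple k e) \<le> (real k)\<^sup>2 * defect f e"
proof (induction k)
  case 0
  then show ?case by (simp add: defect_def)
next
  case (Suc k)
  show ?case
  proof (cases "k = 0")
    case True
    then show ?thesis by simp
  next
    case False
    then have k: "real k > 0" by simp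
    \<comment> \<open>The weight \<open>t = k\<close> is the optimal split between \<open>k\<close> translations and one more.\<close>
    have "defect f (nat_multiple k e + e) \<le> (1 + 1 / real k) * defect f (nat_multiple k e) + (1 + real k) * defect f e"
      by (rule defect_add_le[OF assms k])
    also have "\<dots> \<le> (1 + 1 / real k) * ((real k)\<^sup>2 * defect f e) + (1 + real k) * defect f e"
      by (intro add_right_mono mult_left_mono Suc) simp
    also have "\<dots> = (real (Suc k))\<^sup>2 * defect f e"
      using k by (simp add: field_simps power2_eq_square)
    finally show ?thesis by simp
  qed
qed

text \<open>
  Averaging \<open>f\<close> over the translates by \<open>V\<close> bounds it by \<open>1 / card V\<close>, because the total mass is 1. Hence
  \<open>\<parallel>f\<parallel>\<^sup>2\<close> is at most \<open>1 / card V\<close> up to the average defect over \<open>V\<close>. This is the mechanism behind Nash's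
  inequality.
\<close>
lemma card_mult_autocorr_0_le:
  assumes "mass_function f" "finite V"
  shows "real (card V) * autocorr f 0 \<le> 1 + (\<Sum>v\<in>V. defect f v)"
proof -
  have "(\<Sum>v\<in>V. autocorr f (v - 0)) \<le> 1"
  proof (rule has_sum_mono)
    show "((\<lambda>x. \<Sum>v\<in>V. f (x + 0) * f (x + v)) has_sum (\<Sum>v\<in>V. autocorr f (v - 0))) UNIV"
      by (intro has_sum_finite_sum autocorr_has_sum assms)
    show "(f has_sum 1) UNIV"
      using assms by (simp add: mass_function_def)
    show "(\<Sum>v\<in>V. f (x + 0) * f (x + v)) \<le> f x" for x
    proof -
      have "(\<Sum>v\<in>V. f (x + v)) = sum f ((\<lambda>v. x + v) ` V)"
        by (subst sum.reindex) (auto simp: inj_on_def)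
      also have "\<dots> \<le> 1"
        using assms by (intro mass_function_sum_le_1) auto
      finally have "f x * (\<Sum>v\<in>V. f (x + v)) \<le> f x * 1"
        by (intro mult_left_mono mass_function_nonneg assms)
      then show ?thesis by (simp add: sum_distrib_left)
    qed
  qed
  then show ?thesis
    by (simp add: defect_def sum_subtractf)
qed

section \<open>Energy loss in one step of a walk\<close>

definition walk_step :: "'g::ab_group_add set \<Rightarrow> ('g \<Rightarrow> real) \<Rightarrow> 'g \<Rightarrow> real" where
  "walk_step N f y = (\<Sum>e\<in>N. f (y - e)) / real (card N)"

lemma autocorr_walk_step_has_sum:
  assumes "mass_function f"
  shows "((\<lambda>x. (walk_step N f x)\<^sup>2) has_sum
    (\<Sum>e\<in>N. \<Sum>e'\<in>N. autocorr f (e - e')) / (real (card N))\<^sup>2) UNIV"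
proof -
  have "((\<lambda>x. \<Sum>e\<in>N. \<Sum>e'\<in>N. f (x + - e) * f (x + - e')) has_sum
      (\<Sum>e\<in>N. \<Sum>e'\<in>N. autocorr f (- e' - (- e)))) UNIV"
    by (intro has_sum_finite_sum autocorr_has_sum assms)
  from has_sum_cmult_right[OF this, of "1 / (real (card N))\<^sup>2"] show ?thesis
    by (simp add: walk_step_def power_divide power2_eq_square sum_product)
qed

text \<open>
  The energy \<open>\<parallel>f\<parallel>\<^sup>2\<close> lost in one step is the average of \<open>defect f (e - e')\<close> over pairs of steps, since
  \<open>\<parallel>walk_step N f\<parallel>\<^sup>2\<close> averages \<open>autocorr f (e - e')\<close>. All terms are nonnegative, and the pair \<open>e\<close>, \<open>-e\<close>
  contributes the defect of the translation by \<open>e + e\<close>. Only these doubled steps are controlled: the walk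
  may be periodic, and \<open>f\<close> can be far from its translate by a single step.
\<close>
lemma autocorr_0_decrease:
  assumes "mass_function f" "finite N" "e \<in> N" "- e \<in> N"
  shows "defect f (e + e) \<le> (real (card N))\<^sup>2 * (autocorr f 0 - autocorr (walk_step N f) 0)"
proof -
  have c: "card N > 0" using assms by (auto simp: card_gt_0_iff)
  have "autocorr (walk_step N f) 0 = (\<Sum>e\<in>N. \<Sum>e'\<in>N. autocorr f (e - e')) / (real (card N))\<^sup>2"
    using infsumI[OF autocorr_walk_step_has_sum[OF assms(1)]] by (simp add: autocorr_def power2_eq_square)
  then have "(real (card N))\<^sup>2 * (autocorr f 0 - autocorr (walk_step N f) 0)
     = (real (card N))\<^sup>2 * autocorr f 0 - (\<Sum>e\<in>N. \<Sum>e'\<in>N. autocorr f (e - e'))"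
    using c by (simp add: field_simps)
  also have "\<dots> = (\<Sum>e\<in>N. \<Sum>e'\<in>N. defect f (e - e'))"
    by (simp add: defect_def sum_subtractf power2_eq_square)
  also have "\<dots> \<ge> (\<Sum>e'\<in>N. defect f (e - e'))"
    using assms by (intro member_le_sum sum_nonneg defect_nonneg) auto
  moreover have "(\<Sum>e'\<in>N. defect f (e - e')) \<ge> defect f (e - (- e))"
    using assms by (intro member_le_sum[of "- e" N "\<lambda>e'. defect f (e - e')"] defect_nonneg) auto
  ultimately show ?thesis by simp
qed

lemma mass_function_walk_step:
  assumes "mass_function f" "finite N" "N \<noteq> {}"
  shows "mass_function (walk_step N f)"
proof -
  have "((\<lambda>x. f (x + - e)) has_sum 1) UNIV" for e
    using assms(1) by (subst has_sum_translate) (simp add: mass_function_def)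
  then have "((\<lambda>x. (1 / real (card N)) * (\<Sum>e\<in>N. f (x + - e))) has_sum
      (1 / real (card N)) * (\<Sum>e\<in>N. 1)) UNIV"
    by (intro has_sum_cmult_right has_sum_finite_sum)
  moreover have "walk_step N f = (\<lambda>x. (1 / real (card N)) * (\<Sum>e\<in>N. f (x + - e)))"
    by (simp add: walk_step_def fun_eq_iff)
  ultimately have "(walk_step N f has_sum 1) UNIV"
    using assms by simp
  moreover have "0 \<le> walk_step N f x" for x
    using mass_function_nonneg[OF assms(1)] by (simp add: walk_step_def sum_nonneg)
  ultimately show ?thesis
    by (simp add: mass_function_def)
qed

section \<open>Finite total energy in three independent directions\<close>

text \<open>
  Comparison with the average over a three-dimensional box of side \<open>R\<close>: it has \<open>R\<^sup>3\<close> points, and each is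
  reached by at most \<open>R\<close> translations in each of three directions, which costs at most \<open>10 R\<^sup>2 D\<close>.
\<close>
lemma card_box_autocorr_0_le:
  assumes f: "mass_function f"
    and D: "defect f a \<le> D" "defect f b \<le> D" "defect f c \<le> D"
    and inj: "inj (\<lambda>(i, j, k). nat_multiple i a + nat_multiple j b + nat_multiple k c)"
  shows "real R ^ 3 * autocorr f 0 \<le> 1 + real R ^ 3 * (10 * (real R)\<^sup>2 * D)"
proof -
  define Q where "Q = {..<R} \<times> {..<R} \<times> {..<R}"
  define h where "h = (\<lambda>(i, j, k). nat_multiple i a + nat_multiple j b + nat_multiple k c)"
  have injh: "inj_on h Q"
    using inj unfolding h_def by (rule inj_on_subset) simp
  have cV: "real (card (h ` Q)) = real R ^ 3"
    by (simp add: card_image[OF injh]) (simp add: Q_def card_cartesian_product power3_eq_cube)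
  have one: "defect f (nat_multiple k e) \<le> (real R)\<^sup>2 * D" if "k < R" "defect f e \<le> D" for k e
  proof -
    have "defect f (nat_multiple k e) \<le> (real k)\<^sup>2 * defect f e"
      by (rule defect_nat_multiple_le[OF f])
    also have "\<dots> \<le> (real R)\<^sup>2 * D"
      using that defect_nonneg[OF f] by (intro mult_mono power_mono) auto
    finally show ?thesis .
  qed
  have "defect f v \<le> 10 * (real R)\<^sup>2 * D" if in_box: "v \<in> h ` Q" for v
  proof -
    obtain i j k where v: "v = nat_multiple i a + nat_multiple j b + nat_multiple k c" and ijk: "i < R" "j < R" "k < R"
      using in_box unfolding h_def Q_def by auto
    have "defect f v \<le> 2 * defect f (nat_multiple i a + nat_multiple j b) + 2 * defect f (nat_multiple k c)"
      using defect_add_le[OF f, of 1] by (simp add: v)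
    moreover have "defect f (nat_multiple i a + nat_multiple j b) \<le> 2 * defect f (nat_multiple i a) + 2 * defect f (nat_multiple j b)"
      using defect_add_le[OF f, of 1] by simp
    ultimately show ?thesis
      using one[OF ijk(1) D(1)] one[OF ijk(2) D(2)] one[OF ijk(3) D(3)] by simp
  qed
  then have "(\<Sum>v\<in>h ` Q. defect f v) \<le> real (card (h ` Q)) * (10 * (real R)\<^sup>2 * D)"
    by (rule sum_bounded_above)
  moreover have "real (card (h ` Q)) * autocorr f 0 \<le> 1 + (\<Sum>v\<in>h ` Q. defect f v)"
    by (rule card_mult_autocorr_0_le[OF f]) (simp add: Q_def)
  ultimately show ?thesis
    by (simp add: cV)
qed

text \<open>
  Optimising the box bound over \<open>R\<close>, at \<open>R\<close> of order \<open>u powr (-1/3)\<close>, gives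
  \<open>u \<le> C' u powr (-2/3) (u - v)\<close>. The right-hand side is a discrete form of the differential of
  \<open>3 u powr (1/3)\<close>, so it is bounded by a difference of cube roots.
\<close>
lemma le_cube_root_decrement:
  fixes u v C :: real
  assumes "0 \<le> v" "v \<le> u" "u \<le> 1" "0 \<le> C"
    and bound: "\<And>R::nat. R > 0 \<Longrightarrow> u \<le> 1 / real R ^ 3 + C * (real R)\<^sup>2 * (u - v)"
  shows "u \<le> 54 * C * (root 3 u - root 3 v)"
proof (cases "u = 0")
  case True
  then show ?thesis using assms by simp
next
  case False
  define a where "a = root 3 u"
  define b where "b = root 3 v"
  have u: "u = a ^ 3" and v: "v = b ^ 3"
    using assms by (simp_all add: a_def b_def)
  have a: "0 < a" "a \<le> 1" and b: "0 \<le> b" "b \<le> a"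
    using assms False by (simp_all add: a_def b_def)
  \<comment> \<open>Large enough that \<open>1 / R\<^sup>3 \<le> u / 8\<close>, but at most \<open>3 / a\<close> because \<open>a \<le> 1\<close>.\<close>
  define R where "R = nat \<lceil>2 / a\<rceil>"
  have R1: "2 / a \<le> real R" and R2: "real R \<le> 3 / a"
  proof -
    show "2 / a \<le> real R" unfolding R_def by linarith
    have "real R \<le> 2 / a + 1" using a unfolding R_def by (simp add: of_nat_nat)
    also have "\<dots> \<le> 3 / a" using a by (simp add: field_simps)
    finally show "real R \<le> 3 / a" .
  qed
  have Rpos: "real R > 0"
    using R1 a by (smt (verit) divide_pos_pos)
  have "1 / real R ^ 3 = (1 / real R) ^ 3"
    by (simp add: power_divide)
  also have "\<dots> \<le> (a / 2) ^ 3"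
    using R1 Rpos a by (intro power_mono) (simp_all add: field_simps)
  finally have "1 / real R ^ 3 \<le> (a / 2) ^ 3" .
  then have 1: "1 / real R ^ 3 \<le> u / 2"
  proof -
    have "(a / 2) ^ 3 = u / 8" by (simp add: u power_divide)
    then show ?thesis using \<open>1 / real R ^ 3 \<le> (a / 2) ^ 3\<close> assms by linarith
  qed
  have cubes: "a ^ 3 - b ^ 3 \<le> 3 * a\<^sup>2 * (a - b)"
  proof -
    have "a ^ 3 - b ^ 3 = (a\<^sup>2 + a * b + b * b) * (a - b)"
      by (simp add: power2_eq_square power3_eq_cube algebra_simps)
    also have "\<dots> \<le> (3 * a\<^sup>2) * (a - b)"
    proof (rule mult_right_mono)
      show "a\<^sup>2 + a * b + b * b \<le> 3 * a\<^sup>2"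
      proof -
        have "a * b \<le> a * a" "b * b \<le> a * a"
          using a b by (auto intro: mult_mono)
        then show ?thesis by (simp add: power2_eq_square)
      qed
    qed (use b in simp)
    finally show ?thesis .
  qed
  have "C * (real R)\<^sup>2 * (u - v) \<le> C * (3 / a)\<^sup>2 * (3 * a\<^sup>2 * (a - b))"
    using R2 assms cubes a b unfolding u v
    by (intro mult_mono power_mono mult_left_mono) auto
  also have "\<dots> = 27 * C * (a - b)"
    using a by (simp add: field_simps power2_eq_square)
  finally have "u \<le> u / 2 + 27 * C * (a - b)"
    using bound[of R] Rpos 1 by simp
  then show ?thesis by (simp add: a_def b_def)
qed

text \<open>
  The cube-root differences telescope, so the sum is bounded without an explicit decay rate. The
  exponent 3 is essential to this: a bound \<open>1 / R ^ m\<close> would give \<open>u \<le> C' u powr (-2/m) (u - v)\<close>, and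
  \<open>u powr (-2/m)\<close> is integrable at 0 only for \<open>m > 2\<close>.
\<close>
lemma partial_sums_bounded_of_cube_decay:
  fixes u :: "nat \<Rightarrow> real"
  assumes "\<And>n. 0 \<le> u n" "\<And>n. u (Suc n) \<le> u n" "u 0 \<le> 1" "0 \<le> C"
    and "\<And>n R. R > 0 \<Longrightarrow> u n \<le> 1 / real R ^ 3 + C * (real R)\<^sup>2 * (u n - u (Suc n))"
  shows "(\<Sum>k<n. u k) \<le> 54 * C"
proof -
  have le1: "u k \<le> 1" for k
    using assms(3) by (induction k) (auto intro: order_trans[OF assms(2)])
  have "(\<Sum>k<n. u k) \<le> (\<Sum>k<n. 54 * C * (root 3 (u k) - root 3 (u (Suc k))))"
    using assms le1 by (intro sum_mono le_cube_root_decrement) auto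
  also have "\<dots> = 54 * C * (root 3 (u 0) - root 3 (u n))"
    by (simp add: sum_distrib_left[symmetric] sum_lessThan_telescope'[of "\<lambda>k. root 3 (u k)"])
  also have "\<dots> \<le> 54 * C * 1"
  proof (intro mult_left_mono)
    have "root 3 (u 0) \<le> 1" "0 \<le> root 3 (u n)"
      using le1[of 0] assms(1)[of n] by simp_all
    then show "root 3 (u 0) - root 3 (u n) \<le> 1" by linarith
  qed (use assms in simp)
  finally show ?thesis by simp
qed

lemma autocorr_0_bounds:
  assumes "mass_function f"
  shows "0 \<le> autocorr f 0" "autocorr f 0 \<le> 1"
proof -
  show "0 \<le> autocorr f 0"
    unfolding autocorr_def using mass_function_nonneg[OF assms] by (intro infsum_nonneg) simp
  show "autocorr f 0 \<le> 1"
    using card_mult_autocorr_0_le[OF assms, of "{0}"] by (simp add: defect_def)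
qed

text \<open>
  The transience half, for a walk on any abelian group whose steps contain three independent
  directions: the one-step energy loss dominates the defects along doubled steps, and these are the
  price in the box bound.
\<close>
lemma walk_autocorr_0_sums_bounded:
  fixes p :: "nat \<Rightarrow> 'g::ab_group_add \<Rightarrow> real"
  assumes p0: "mass_function (p 0)" and pS: "\<And>n. p (Suc n) = walk_step N (p n)"
    and N: "finite N" "a \<in> N" "- a \<in> N" "b \<in> N" "- b \<in> N" "c \<in> N" "- c \<in> N"
    and inj: "inj (\<lambda>(i, j, k). nat_multiple i (a + a) + nat_multiple j (b + b) + nat_multiple k (c + c))"
  shows "(\<Sum>k<n. autocorr (p k) 0) \<le> 540 * (real (card N))\<^sup>2"
proof -
  have mf: "mass_function (p n)" for n
    by (induction n) (use p0 pS N mass_function_walk_step in auto)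
  have decr: "defect (p n) (e + e) \<le> (real (card N))\<^sup>2 * (autocorr (p n) 0 - autocorr (p (Suc n)) 0)"
    if "e \<in> N" "- e \<in> N" for n e
    unfolding pS by (rule autocorr_0_decrease[OF mf N(1) that])
  have cN: "(real (card N))\<^sup>2 > 0"
    using N by (auto simp: card_gt_0_iff)
  have "(\<Sum>k<n. autocorr (p k) 0) \<le> 54 * (10 * (real (card N))\<^sup>2)"
  proof (rule partial_sums_bounded_of_cube_decay)
    fix n
    show "0 \<le> autocorr (p n) 0"
      by (rule autocorr_0_bounds[OF mf])
    have "0 \<le> (real (card N))\<^sup>2 * (autocorr (p n) 0 - autocorr (p (Suc n)) 0)"
      using decr[OF N(2,3), of n] defect_nonneg[OF mf, of n "a + a"] by linarith
    then show "autocorr (p (Suc n)) 0 \<le> autocorr (p n) 0"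
      using cN by (simp add: zero_le_mult_iff)
  next
    fix n R :: nat
    assume "R > 0"
    then show "autocorr (p n) 0 \<le> 1 / real R ^ 3 + 10 * (real (card N))\<^sup>2 * (real R)\<^sup>2 * (autocorr (p n) 0 - autocorr (p (Suc n)) 0)"
      using card_box_autocorr_0_le[OF mf decr[OF N(2,3)] decr[OF N(4,5)] decr[OF N(6,7)] inj, of R n]
      by (simp add: field_simps)
  qed (use autocorr_0_bounds[OF p0] in auto)
  then show ?thesis by simp
qed

section \<open>The steps of simple random walk\<close>

definition real_point :: "int ^ 'd \<Rightarrow> real ^ 'd" where
  "real_point x = (\<chi> i. real_of_int (x $ i))"

lemma real_point_add: "real_point (x + y) = real_point x + real_point y"
  and real_point_diff: "real_point (x - y) = real_point x - real_point y"
  and real_point_minus: "real_point (- x) = - real_point x"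
  by (simp_all add: real_point_def vec_eq_iff)

text \<open>
  Membership is stated through the norm, which makes the link with \<^const>\<open>srw_kernel\<close> and the symmetry
  under negation immediate; the description by coordinate vectors is \<open>unit_steps_eq\<close>.
\<close>
definition unit_steps :: "(int ^ 'd) set" where
  "unit_steps = {e. norm (real_point e) = 1}"

lemma norm_real_point_eq_1_iff:
  "norm (real_point (e :: int ^ 'd::finite)) = 1 \<longleftrightarrow> (\<Sum>i\<in>UNIV. (e $ i)\<^sup>2) = 1"
proof -
  have "norm (real_point e) = 1 \<longleftrightarrow> real_of_int (\<Sum>i\<in>UNIV. (e $ i)\<^sup>2) = 1"
    by (simp add: norm_eq_1 inner_vec_def real_point_def power2_eq_square)
  then show ?thesis by linarith
qed

text \<open>
  A sum of squares of integers equals 1 only if one of them is \<open>\<plusminus>1\<close> and the others vanish.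
\<close>
lemma unit_steps_eq:
  "(unit_steps :: (int ^ 'd::finite) set) = range (\<lambda>i. axis i 1) \<union> range (\<lambda>i. axis i (- 1))"
proof (intro equalityI subsetI)
  fix e :: "int ^ 'd"
  assume "e \<in> unit_steps"
  then have s: "(\<Sum>i\<in>UNIV. (e $ i)\<^sup>2) = 1"
    by (simp add: unit_steps_def norm_real_point_eq_1_iff)
  then obtain i where i: "e $ i \<noteq> 0"
    by (metis (no_types, lifting) sum.neutral zero_neq_one zero_eq_power2)
  have "(\<Sum>j\<in>UNIV. (e $ j)\<^sup>2) = (e $ i)\<^sup>2 + (\<Sum>j\<in>UNIV - {i}. (e $ j)\<^sup>2)"
    by (simp add: sum.remove)
  moreover have "(e $ i)\<^sup>2 \<ge> 1"
    using i by (smt (verit) zero_less_power2)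
  moreover have "(\<Sum>j\<in>UNIV - {i}. (e $ j)\<^sup>2) \<ge> 0"
    by (simp add: sum_nonneg)
  ultimately have "(e $ i)\<^sup>2 = 1" and z: "(\<Sum>j\<in>UNIV - {i}. (e $ j)\<^sup>2) = 0"
    using s by linarith+
  have "e $ j = 0" if "j \<noteq> i" for j
    using z that by (simp add: sum_nonneg_eq_0_iff)
  moreover have "e $ i = 1 \<or> e $ i = - 1"
    using \<open>(e $ i)\<^sup>2 = 1\<close> by (simp add: power2_eq_1_iff)
  ultimately have "e = axis i 1 \<or> e = axis i (- 1)"
    by (auto simp: vec_eq_iff axis_def)
  then show "e \<in> range (\<lambda>i. axis i 1) \<union> range (\<lambda>i. axis i (- 1))" by blast
next
  fix e :: "int ^ 'd"
  assume "e \<in> range (\<lambda>i. axis i 1) \<union> range (\<lambda>i. axis i (- 1))"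
  then obtain i s where e: "e = axis i s" "s\<^sup>2 = 1" by auto
  have "(\<Sum>j\<in>UNIV. (e $ j)\<^sup>2) = (\<Sum>j\<in>UNIV. if j = i then 1 else 0)"
    using e by (intro sum.cong) (auto simp: axis_def)
  then show "e \<in> unit_steps"
    by (simp add: unit_steps_def norm_real_point_eq_1_iff)
qed

lemma axis_in_unit_steps: "axis i 1 \<in> unit_steps" "- axis i 1 \<in> unit_steps"
proof -
  have "- axis i (1 :: int) = axis i (- 1)" by (simp add: vec_eq_iff axis_def)
  then show "axis i 1 \<in> unit_steps" "- axis i 1 \<in> unit_steps"
    by (auto simp: unit_steps_eq)
qed

lemma finite_unit_steps: "finite (unit_steps :: (int ^ 'd::finite) set)"
  by (simp add: unit_steps_eq)

lemma card_unit_steps: "card (unit_steps :: (int ^ 'd::finite) set) = 2 * CARD('d)"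
proof -
  have "inj (\<lambda>i. axis i s :: int ^ 'd)" if "s \<noteq> 0" for s
    using that by (auto simp: inj_on_def axis_eq_axis)
  moreover have "range (\<lambda>i. axis i 1 :: int ^ 'd) \<inter> range (\<lambda>i. axis i (- 1)) = {}"
    by (auto simp: axis_eq_axis)
  ultimately show ?thesis
    unfolding unit_steps_eq by (subst card_Un_disjoint) (simp_all add: card_image)
qed

lemma uminus_unit_steps: "bij_betw uminus unit_steps unit_steps"
proof (rule bij_betwI[where g = uminus])
  show "uminus \<in> unit_steps \<rightarrow> unit_steps" "uminus \<in> unit_steps \<rightarrow> unit_steps"
    by (auto simp: unit_steps_def real_point_minus)
qed simp_all

lemma srw_kernel_eq:
  "srw_kernel x y = (if y - x \<in> unit_steps then 1 / real (card (unit_steps :: (int ^ 'd::finite) set)) else 0)"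
  for x y :: "int ^ 'd"
proof -
  have "lattice_dist x y = norm (real_point x - real_point y)"
    by (simp add: lattice_dist_def real_point_def vec_eq_iff minus_vec_def)
  then have "lattice_dist x y = norm (real_point (y - x))"
    by (simp add: real_point_diff norm_minus_commute)
  then show ?thesis
    by (simp add: srw_kernel_def unit_steps_def card_unit_steps[unfolded unit_steps_def])
qed

text \<open>
  Pairing \<open>e\<close> with \<open>-e\<close> and the parallelogram law remove the linear terms.
\<close>
lemma sum_unit_steps_norm_square:
  fixes z :: "real ^ 'd::finite"
  shows "(\<Sum>e\<in>unit_steps. (norm (z + real_point e))\<^sup>2) = real (card (unit_steps :: (int ^ 'd) set)) * ((norm z)\<^sup>2 + 1)"
proof -
  let ?N = "unit_steps :: (int ^ 'd) set"
  have "(\<Sum>e\<in>?N. (norm (z + real_point e))\<^sup>2) = (\<Sum>e\<in>?N. (norm (z + real_point (- e)))\<^sup>2)"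
    by (rule sum.reindex_bij_betw[OF uminus_unit_steps, symmetric])
  then have "2 * (\<Sum>e\<in>?N. (norm (z + real_point e))\<^sup>2)
      = (\<Sum>e\<in>?N. (norm (z + real_point e))\<^sup>2 + (norm (z + real_point (- e)))\<^sup>2)"
    by (simp add: sum.distrib)
  also have "\<dots> = (\<Sum>e\<in>?N. 2 * ((norm z)\<^sup>2 + 1))"
  proof (rule sum.cong)
    fix e assume "e \<in> ?N"
    then have "real_point e \<bullet> real_point e = 1"
      by (simp add: unit_steps_def norm_eq_1)
    then show "(norm (z + real_point e))\<^sup>2 + (norm (z + real_point (- e)))\<^sup>2 = 2 * ((norm z)\<^sup>2 + 1)"
      by (simp add: real_point_minus power2_norm_eq_inner inner_add_left inner_add_right inner_diff_left inner_diff_right inner_commute)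
  qed simp
  also have "\<dots> = 2 * (real (card ?N) * ((norm z)\<^sup>2 + 1))"
    by simp
  finally show ?thesis by (simp only: mult_cancel_left) simp
qed

section \<open>Divergence of the total energy in dimension at most two\<close>

text \<open>
  Each step adds 1 to the mean squared distance from the starting point, by
  \<open>sum_unit_steps_norm_square\<close>.
\<close>
lemma walk_second_moment:
  fixes p :: "nat \<Rightarrow> int ^ 'd::finite \<Rightarrow> real"
  assumes p0: "p 0 = (\<lambda>x. if x = x0 then 1 else 0)" and pS: "\<And>n. p (Suc n) = walk_step unit_steps (p n)"
    and nonneg: "\<And>n x. 0 \<le> p n x" and mass: "\<And>n. (p n has_sum 1) UNIV"
  shows "((\<lambda>x. p n x * (norm (real_point (x - x0)))\<^sup>2) has_sum real n) UNIV"
proof (induction n)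
  case 0
  have "p 0 x * (norm (real_point (x - x0)))\<^sup>2 = 0" for x
    by (simp add: p0 real_point_diff)
  then have "(\<lambda>x. p 0 x * (norm (real_point (x - x0)))\<^sup>2) = (\<lambda>x. 0)" by (rule ext)
  then show ?case by (simp only: has_sum_0_simp of_nat_0)
next
  case (Suc n)
  define N where "N = (unit_steps :: (int ^ 'd) set)"
  define g where "g = (\<lambda>x :: int ^ 'd. (norm (real_point (x - x0)))\<^sup>2)"
  have g0: "0 \<le> g x" for x by (simp add: g_def)
  have cN: "real (card N) > 0" by (simp add: N_def card_unit_steps)
  have avg: "(\<Sum>e\<in>N. g (x + e)) = real (card N) * (g x + 1)" for x
    using sum_unit_steps_norm_square[of "real_point (x - x0)"]
    by (simp add: g_def N_def real_point_add real_point_diff algebra_simps)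
  have IH: "((\<lambda>x. p n x * g x) has_sum real n) UNIV"
    using Suc by (simp add: g_def)
  have total: "((\<lambda>x. real (card N) * (p n x * g x + p n x)) has_sum real (card N) * (real n + 1)) UNIV"
    by (intro has_sum_cmult_right has_sum_add IH mass)
  define s where "s = (\<lambda>e. \<Sum>\<^sub>\<infinity>x. p n x * g (x + e))"
  have s: "((\<lambda>x. p n x * g (x + e)) has_sum s e) UNIV" if "e \<in> N" for e
    unfolding s_def
  proof (rule has_sum_infsum, rule summable_on_comparison_test)
    show "(\<lambda>x. real (card N) * (p n x * g x + p n x)) summable_on UNIV"
      using total by (rule has_sum_imp_summable)
    \<comment> \<open>A single term of a nonnegative sum is bounded by the whole sum, which \<open>avg\<close> evaluates.\<close>
    show "p n x * g (x + e) \<le> real (card N) * (p n x * g x + p n x)" for x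
    proof -
      have "g (x + e) \<le> (\<Sum>e\<in>N. g (x + e))"
        using that g0 finite_unit_steps by (intro member_le_sum) (auto simp: N_def)
      then have "p n x * g (x + e) \<le> p n x * (real (card N) * (g x + 1))"
        unfolding avg by (intro mult_left_mono nonneg)
      then show ?thesis by (simp add: algebra_simps)
    qed
  qed (use nonneg g0 in auto)
  have "((\<lambda>x. \<Sum>e\<in>N. p n x * g (x + e)) has_sum (\<Sum>e\<in>N. s e)) UNIV"
    by (intro has_sum_finite_sum s)
  moreover have "(\<lambda>x. \<Sum>e\<in>N. p n x * g (x + e)) = (\<lambda>x. real (card N) * (p n x * g x + p n x))"
    by (simp add: fun_eq_iff sum_distrib_left[symmetric] avg algebra_simps)
  ultimately have S: "(\<Sum>e\<in>N. s e) = real (card N) * (real n + 1)"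
    using total by (simp add: has_sum_unique)
  have "((\<lambda>x. p n (x + - e) * g (x + - e + e)) has_sum s e) UNIV" if "e \<in> N" for e
    using s[OF that] by (subst has_sum_translate[where f = "\<lambda>x. p n x * g (x + e)"])
  then have "((\<lambda>x. (1 / real (card N)) * (\<Sum>e\<in>N. p n (x + - e) * g (x + - e + e)))
      has_sum (1 / real (card N)) * (\<Sum>e\<in>N. s e)) UNIV"
    by (intro has_sum_cmult_right has_sum_finite_sum)
  moreover have "(\<lambda>x. (1 / real (card N)) * (\<Sum>e\<in>N. p n (x + - e) * g (x + - e + e))) = (\<lambda>x. p (Suc n) x * g x)"
    by (simp add: fun_eq_iff pS walk_step_def N_def sum_distrib_right)
  ultimately show ?case
    using cN by (simp add: S g_def add.commute)
qed

lemma finite_card_lattice_box: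
  fixes x0 :: "int ^ 'd::finite" and r :: nat
  defines "B \<equiv> {x. \<forall>i. \<bar>x $ i - x0 $ i\<bar> \<le> int r}"
  shows "finite B" "card B \<le> (2 * r + 1) ^ CARD('d)"
proof -
  let ?P = "PiE UNIV (\<lambda>i. {x0 $ i - int r..x0 $ i + int r})"
  have sub: "B \<subseteq> (\<lambda>f. \<chi> i. f i) ` ?P"
  proof
    fix x assume "x \<in> B"
    then have b: "\<bar>x $ i - x0 $ i\<bar> \<le> int r" for i
      by (simp add: B_def)
    have "(\<lambda>i. x $ i) \<in> ?P"
      using b by (auto simp: abs_le_iff) (smt (verit) b)+
    then show "x \<in> (\<lambda>f. \<chi> i. f i) ` ?P" by (rule rev_image_eqI) simp
  qed
  have fin: "finite ?P" by (intro finite_PiE) auto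
  then show "finite B" using sub by (meson finite_imageI finite_subset)
  have "card B \<le> card ((\<lambda>f. (\<chi> i. f i) :: int ^ 'd) ` ?P)"
    using sub fin by (intro card_mono) auto
  also have "\<dots> \<le> card ?P" using fin by (rule card_image_le)
  also have "\<dots> = (2 * r + 1) ^ CARD('d)"
  proof -
    have "nat (int r * 2) = r * 2" by linarith
    then show ?thesis
      by (subst card_PiE) (simp_all add: nat_add_distrib algebra_simps)
  qed
  finally show "card B \<le> (2 * r + 1) ^ CARD('d)" .
qed

text \<open>
  By Chebyshev's inequality, at least half of the mass stays in a box of radius of order \<open>sqrt n\<close>. In dimension at
  most 2 this box has at most \<open>50 n\<close> points, and by the Cauchy--Schwarz inequality a mass of at least
  \<open>1/2\<close> spread over so few points has energy at least \<open>1 / (200 n)\<close>.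
\<close>
lemma walk_autocorr_0_lower_bound:
  fixes p :: "nat \<Rightarrow> int ^ 'd::finite \<Rightarrow> real"
  assumes p0: "p 0 = (\<lambda>x. if x = x0 then 1 else 0)" and pS: "\<And>n. p (Suc n) = walk_step unit_steps (p n)"
    and mf: "\<And>n. mass_function (p n)"
    and d: "CARD('d) \<le> 2" and n: "n > 0"
  shows "autocorr (p n) 0 \<ge> 1 / (200 * real n)"
proof -
  define r where "r = nat \<lceil>sqrt (2 * real n)\<rceil>"
  define B where "B = {x. \<forall>i. \<bar>x $ i - x0 $ i\<bar> \<le> int r}"
  have r1: "sqrt (2 * real n) \<le> real r" and r2: "real r \<le> sqrt (2 * real n) + 1"
    unfolding r_def by (linarith, simp add: of_nat_nat)
  have r3: "2 * real n \<le> (real r)\<^sup>2"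
    using power_mono[OF r1, of 2] by simp
  have sq1: "1 \<le> sqrt (2 * real n)"
    using n by simp
  have finB: "finite B"
    unfolding B_def by (rule finite_card_lattice_box)
  have "real (card B) \<le> (2 * real r + 1) ^ CARD('d)"
    using finite_card_lattice_box(2)[of x0 r] unfolding B_def
    by (metis (mono_tags, lifting) of_nat_1 of_nat_add of_nat_le_iff of_nat_mult of_nat_numeral of_nat_power)
  also have "\<dots> \<le> (2 * real r + 1)\<^sup>2"
    using d by (intro power_increasing) auto
  also have "\<dots> \<le> (5 * sqrt (2 * real n))\<^sup>2"
  proof (rule power_mono)
    show "2 * real r + 1 \<le> 5 * sqrt (2 * real n)" using r2 sq1 by linarith
  qed simp
  also have "\<dots> = 50 * real n"
    by (simp add: power_mult_distrib)
  finally have cB: "real (card B) \<le> 50 * real n" .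
  have mass: "(p n has_sum 1) UNIV" and nonneg: "0 \<le> p n x" for n x
    using mf[of n] by (simp_all add: mass_function_def)
  have rpos: "(real r)\<^sup>2 > 0" using r3 n by linarith
  \<comment> \<open>Chebyshev, as a pointwise comparison of \<open>1 - |x - x0|\<^sup>2 / r\<^sup>2\<close> with the indicator of \<open>B\<close>.\<close>
  have "1 - 1 / (real r)\<^sup>2 * real n \<le> sum (p n) B"
  proof (rule has_sum_mono)
    have "((\<lambda>x. p n x + (- 1 / (real r)\<^sup>2) * (p n x * (norm (real_point (x - x0)))\<^sup>2)) has_sum
        1 + (- 1 / (real r)\<^sup>2) * real n) UNIV"
      by (intro has_sum_add has_sum_cmult_right mass walk_second_moment p0 pS nonneg)
    then show "((\<lambda>x. p n x - 1 / (real r)\<^sup>2 * (p n x * (norm (real_point (x - x0)))\<^sup>2)) has_sum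
        1 - 1 / (real r)\<^sup>2 * real n) UNIV" by simp
    show "((\<lambda>x. if x \<in> B then p n x else 0) has_sum sum (p n) B) UNIV"
      by (rule has_sum_finite_neutralI[OF finB]) auto
    show "p n x - 1 / (real r)\<^sup>2 * (p n x * (norm (real_point (x - x0)))\<^sup>2) \<le> (if x \<in> B then p n x else 0)" for x
    proof (cases "x \<in> B")
      case True
      then show ?thesis using nonneg by simp
    next
      case False
      then obtain i where "int r \<le> \<bar>x $ i - x0 $ i\<bar>" by (auto simp: B_def not_le intro: less_imp_le)
      then have "real r \<le> \<bar>real_point (x - x0) $ i\<bar>"
        by (simp add: real_point_def)
      also have "\<dots> \<le> norm (real_point (x - x0))" by (rule component_le_norm_cart)
      finally have "(real r)\<^sup>2 \<le> (norm (real_point (x - x0)))\<^sup>2" by (intro power_mono) auto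
      then have "p n x * (real r)\<^sup>2 \<le> p n x * (norm (real_point (x - x0)))\<^sup>2"
        by (intro mult_left_mono nonneg)
      then show ?thesis using False rpos by (simp add: field_simps)
    qed
  qed
  moreover have "1 / (real r)\<^sup>2 * real n \<le> 1 / 2"
    using r3 rpos by (simp add: field_simps)
  ultimately have half: "1 / 2 \<le> sum (p n) B" by linarith
  have "(1 / 2)\<^sup>2 \<le> (sum (p n) B)\<^sup>2"
    using half by (intro power_mono) auto
  also have "\<dots> \<le> (\<Sum>x\<in>B. (p n x)\<^sup>2) * real (card B)"
    by (rule sum_squared_le_sum_of_squares)
  also have "\<dots> \<le> autocorr (p n) 0 * (50 * real n)"
  proof (rule mult_mono)
    show "(\<Sum>x\<in>B. (p n x)\<^sup>2) \<le> autocorr (p n) 0"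
      using autocorr_has_sum[OF mf, of n 0 0] finB
      by (intro finite_sum_le_has_sum[where A = UNIV]) (auto simp: power2_eq_square)
  qed (use cB autocorr_0_bounds[OF mf] in auto)
  finally show ?thesis
    using n by (simp add: field_simps power2_eq_square)
qed

lemma nat_multiple_nth: "nat_multiple k e $ i = int k * e $ i" for e :: "int ^ 'd"
  by (induction k) (simp_all add: algebra_simps)

lemma inj_coordinate_box:
  fixes i1 i2 i3 :: "'d::finite"
  assumes "i1 \<noteq> i2" "i1 \<noteq> i3" "i2 \<noteq> i3"
  shows "inj (\<lambda>(i, j, k). nat_multiple i (axis i1 1 + axis i1 1) + nat_multiple j (axis i2 1 + axis i2 1)
    + nat_multiple k (axis i3 1 + axis i3 1) :: int ^ 'd)"
  (is "inj ?h")
proof -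
  have "?h (i, j, k) $ i1 = 2 * int i" "?h (i, j, k) $ i2 = 2 * int j" "?h (i, j, k) $ i3 = 2 * int k" for i j k
    using assms by (simp_all add: nat_multiple_nth axis_def)
  then show ?thesis
    by (intro injI) (smt (verit, best) of_nat_eq_iff prod_cases3)
qed

section \<open>One-dimensional laws of the walks\<close>

lemma (in prob_space) prob_partition_has_sum:
  fixes Z :: "'a \<Rightarrow> 'b::countable"
  assumes Z[measurable]: "Z \<in> measurable M (count_space UNIV)" and A[measurable]: "A \<in> events"
  shows "((\<lambda>z. prob {\<omega>\<in>space M. \<omega> \<in> A \<and> Z \<omega> = z}) has_sum prob A) UNIV"
proof -
  define B where "B = (\<lambda>i::nat. {\<omega>\<in>space M. \<omega> \<in> A \<and> to_nat (Z \<omega>) = i})"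
  have "(\<lambda>i. prob (B i)) sums prob (\<Union>i. B i)"
  proof (rule finite_measure_UNION)
    show "range B \<subseteq> events" unfolding B_def by auto
    show "disjoint_family B" unfolding B_def disjoint_family_on_def by auto
  qed
  moreover have "(\<Union>i. B i) = A"
    using sets.sets_into_space[OF A] by (auto simp: B_def)
  ultimately have "((\<lambda>i. prob (B i)) has_sum prob A) UNIV"
    by (intro sums_nonneg_imp_has_sum) auto
  also have "?this \<longleftrightarrow> ((\<lambda>i. prob (B i)) has_sum prob A) (range (to_nat :: 'b \<Rightarrow> nat))"
  proof (rule has_sum_cong_neutral)
    fix i assume "i \<in> UNIV - range (to_nat :: 'b \<Rightarrow> nat)"
    then have "B i = {}" by (auto simp: B_def)
    then show "prob (B i) = 0" by simp
  qed auto
  also have "\<dots> \<longleftrightarrow> ((\<lambda>i. prob (B i)) \<circ> (to_nat :: 'b \<Rightarrow> nat) has_sum prob A) UNIV"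
    by (rule has_sum_reindex) simp
  finally show ?thesis
    by (simp add: B_def o_def)
qed

text \<open>
  The defining property of \<^const>\<open>markov_chain\<close> conditions on a full history. Summing over the value at
  time \<open>m\<close> forgets one time after another, and \<open>m = n\<close> leaves only the present state. A countable
  sum over one value at a time avoids summing over the space of histories.
\<close>
lemma (in prob_space) markov_chain_recent_history:
  fixes X :: "nat \<Rightarrow> 'a \<Rightarrow> 's::countable"
  assumes mc: "markov_chain M K X" and "m \<le> n"
  shows "prob {\<omega>\<in>space M. (\<forall>k\<in>{m..n}. X k \<omega> = x k) \<and> X (Suc n) \<omega> = y}
    = prob {\<omega>\<in>space M. \<forall>k\<in>{m..n}. X k \<omega> = x k} * K (x n) y"
  using \<open>m \<le> n\<close>
proof (induction m arbitrary: x)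
  case 0
  define P where "P = prob {\<omega>\<in>space M. \<forall>k\<le>n. X k \<omega> = x k}"
  have [measurable]: "\<And>n. X n \<in> measurable M (count_space UNIV)"
    using mc by (auto simp: markov_chain_def)
  show ?case
  proof (cases "P > 0")
    case True
    then have "prob {\<omega>\<in>space M. X (Suc n) \<omega> = y \<and> (\<forall>k\<le>n. X k \<omega> = x k)} / P = K (x n) y"
      using mc unfolding markov_chain_def cond_prob_def P_def by blast
    then show ?thesis
      using True by (simp add: P_def field_simps conj_commute atLeast0AtMost Ball_def)
  next
    case False
    then have "P = 0" by (simp add: P_def zero_less_measure_iff)
    moreover have "prob {\<omega>\<in>space M. (\<forall>k\<le>n. X k \<omega> = x k) \<and> X (Suc n) \<omega> = y} \<le> P"
      unfolding P_def by (intro finite_measure_mono) auto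
    ultimately show ?thesis
      by (simp add: P_def atLeast0AtMost Ball_def measure_le_0_iff)
  qed
next
  case (Suc m)
  have [measurable]: "\<And>n. X n \<in> measurable M (count_space UNIV)"
    using mc by (auto simp: markov_chain_def)
  \<comment> \<open>Prescribing the value \<open>z\<close> at time \<open>m\<close> turns the shorter history into a longer one.\<close>
  have split: "(\<forall>k\<in>{m..n}. X k \<omega> = (x(m := z)) k) \<longleftrightarrow> (\<forall>k\<in>{Suc m..n}. X k \<omega> = x k) \<and> X m \<omega> = z" for \<omega> z
    using Suc.prems by (auto simp: Suc_le_eq le_less)
  let ?H = "{\<omega>\<in>space M. \<forall>k\<in>{Suc m..n}. X k \<omega> = x k}"
  let ?G = "{\<omega>\<in>space M. (\<forall>k\<in>{Suc m..n}. X k \<omega> = x k) \<and> X (Suc n) \<omega> = y}"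
  have step: "prob {\<omega>\<in>space M. \<omega> \<in> ?G \<and> X m \<omega> = z} = prob {\<omega>\<in>space M. \<omega> \<in> ?H \<and> X m \<omega> = z} * K (x n) y" for z
  proof -
    have "{\<omega>\<in>space M. \<omega> \<in> ?G \<and> X m \<omega> = z}
        = {\<omega>\<in>space M. (\<forall>k\<in>{m..n}. X k \<omega> = (x(m := z)) k) \<and> X (Suc n) \<omega> = y}"
      unfolding split by auto
    moreover have "{\<omega>\<in>space M. \<omega> \<in> ?H \<and> X m \<omega> = z} = {\<omega>\<in>space M. \<forall>k\<in>{m..n}. X k \<omega> = (x(m := z)) k}"
      unfolding split by auto
    ultimately show ?thesis
      using Suc.IH[of "x(m := z)"] Suc.prems by simp
  qed
  have "((\<lambda>z. prob {\<omega>\<in>space M. \<omega> \<in> ?G \<and> X m \<omega> = z}) has_sum prob ?G) UNIV"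
    by (rule prob_partition_has_sum) measurable
  moreover have "((\<lambda>z. prob {\<omega>\<in>space M. \<omega> \<in> ?H \<and> X m \<omega> = z} * K (x n) y) has_sum prob ?H * K (x n) y) UNIV"
    by (intro has_sum_cmult_left prob_partition_has_sum) measurable
  then have "((\<lambda>z. prob {\<omega>\<in>space M. \<omega> \<in> ?G \<and> X m \<omega> = z}) has_sum prob ?H * K (x n) y) UNIV"
    by (subst has_sum_cong[OF step])
  ultimately show ?case
    by (rule has_sum_unique)
qed

lemma (in prob_space) mass_function_law:
  fixes Z :: "'a \<Rightarrow> 'b::countable"
  assumes "Z \<in> measurable M (count_space UNIV)"
  shows "mass_function (\<lambda>x. prob {\<omega>\<in>space M. Z \<omega> = x})"
  using prob_partition_has_sum[OF assms sets.top] by (simp add: mass_function_def prob_space)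

text \<open>
  The Chapman--Kolmogorov equation for one step. Together with the initial law it determines all
  one-dimensional laws of the walk.
\<close>
lemma (in prob_space) random_walk_law_Suc:
  fixes X :: "nat \<Rightarrow> 'a \<Rightarrow> int ^ 'd::finite"
  assumes "simple_random_walk M X"
  shows "(\<lambda>x. prob {\<omega>\<in>space M. X (Suc n) \<omega> = x}) = walk_step unit_steps (\<lambda>x. prob {\<omega>\<in>space M. X n \<omega> = x})"
proof
  fix y
  let ?N = "unit_steps :: (int ^ 'd) set"
  let ?p = "\<lambda>x. prob {\<omega>\<in>space M. X n \<omega> = x}"
  have mc: "markov_chain M srw_kernel X"
    using assms by (simp add: simple_random_walk_def)
  have [measurable]: "\<And>n. X n \<in> measurable M (count_space UNIV)"
    using mc by (auto simp: markov_chain_def)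
  have "((\<lambda>x. prob {\<omega>\<in>space M. \<omega> \<in> {\<omega>\<in>space M. X (Suc n) \<omega> = y} \<and> X n \<omega> = x})
      has_sum prob {\<omega>\<in>space M. X (Suc n) \<omega> = y}) UNIV"
    by (rule prob_partition_has_sum) measurable
  moreover have "prob {\<omega>\<in>space M. \<omega> \<in> {\<omega>\<in>space M. X (Suc n) \<omega> = y} \<and> X n \<omega> = x} = ?p x * srw_kernel x y" for x
  proof -
    have "{\<omega>\<in>space M. \<omega> \<in> {\<omega>\<in>space M. X (Suc n) \<omega> = y} \<and> X n \<omega> = x}
        = {\<omega>\<in>space M. (\<forall>k\<in>{n..n}. X k \<omega> = x) \<and> X (Suc n) \<omega> = y}"
      by auto
    then show ?thesis
      using markov_chain_recent_history[OF mc, of n n "\<lambda>_. x" y] by simp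
  qed
  ultimately have "((\<lambda>x. ?p x * srw_kernel x y) has_sum prob {\<omega>\<in>space M. X (Suc n) \<omega> = y}) UNIV"
    by simp
  moreover have "((\<lambda>x. ?p x * srw_kernel x y) has_sum (\<Sum>x\<in>(\<lambda>e. y - e) ` ?N. ?p x * srw_kernel x y)) UNIV"
  proof (rule has_sum_finite_neutralI)
    fix x assume "x \<in> UNIV - (\<lambda>e. y - e) ` ?N"
    moreover have "x = y - (y - x)" by simp
    ultimately have "y - x \<notin> ?N" by blast
    then show "?p x * srw_kernel x y = 0"
      by (simp add: srw_kernel_eq)
  qed (simp_all add: finite_unit_steps)
  ultimately have "prob {\<omega>\<in>space M. X (Suc n) \<omega> = y} = (\<Sum>x\<in>(\<lambda>e. y - e) ` ?N. ?p x * srw_kernel x y)"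
    by (rule has_sum_unique)
  also have "\<dots> = (\<Sum>e\<in>?N. ?p (y - e) * srw_kernel (y - e) y)"
    by (subst sum.reindex) (auto simp: inj_on_def)
  also have "\<dots> = walk_step ?N ?p y"
    by (simp add: walk_step_def srw_kernel_eq sum_divide_distrib)
  finally show "prob {\<omega>\<in>space M. X (Suc n) \<omega> = y} = walk_step ?N ?p y" .
qed

section \<open>Expected number of collisions\<close>

lemma (in prob_space) indep_processes_marginals:
  fixes X Y :: "nat \<Rightarrow> 'a \<Rightarrow> 's"
  assumes "indep_processes M X Y"
  shows "prob {\<omega>\<in>space M. X n \<omega> = x \<and> Y n \<omega> = y} = prob {\<omega>\<in>space M. X n \<omega> = x} * prob {\<omega>\<in>space M. Y n \<omega> = y}"
proof -
  let ?S = "PiM UNIV (\<lambda>_::nat. count_space (UNIV :: 's set))"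
  have iv: "indep_var ?S (\<lambda>\<omega> n. X n \<omega>) ?S (\<lambda>\<omega> n. Y n \<omega>)"
    using assms by (simp add: indep_processes_def)
  have C: "{f \<in> space ?S. f n = z} \<in> sets ?S" for z
    by measurable
  from indep_varD[OF iv C[of x] C[of y]] show ?thesis
    by (simp add: vimage_def Int_def space_PiM conj_commute)
qed

lemma (in prob_space) nn_integral_num_collisions:
  fixes X Y :: "nat \<Rightarrow> 'a \<Rightarrow> 's::countable"
  assumes [measurable]: "\<And>n. X n \<in> measurable M (count_space UNIV)" "\<And>n. Y n \<in> measurable M (count_space UNIV)"
  shows "(\<integral>\<^sup>+\<omega>. num_collisions X Y \<omega> \<partial>M) = (\<Sum>n. ennreal (prob {\<omega>\<in>space M. X n \<omega> = Y n \<omega>}))"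
proof -
  have "num_collisions X Y \<omega> = (\<Sum>n. indicator {\<omega>. X n \<omega> = Y n \<omega>} \<omega>)" for \<omega>
  proof -
    have "num_collisions X Y \<omega> = (\<integral>\<^sup>+n. indicator {n. X n \<omega> = Y n \<omega>} n \<partial>count_space UNIV)"
      by (simp add: num_collisions_def)
    also have "\<dots> = (\<Sum>n. indicator {n. X n \<omega> = Y n \<omega>} n)"
      by (rule nn_integral_count_space_nat)
    finally show ?thesis by (simp add: indicator_def)
  qed
  then have "(\<integral>\<^sup>+\<omega>. num_collisions X Y \<omega> \<partial>M)
      = (\<integral>\<^sup>+\<omega>. (\<Sum>n. indicator {\<omega>\<in>space M. X n \<omega> = Y n \<omega>} \<omega>) \<partial>M)"
    by (intro nn_integral_cong) (simp add: indicator_def)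
  also have "\<dots> = (\<Sum>n. \<integral>\<^sup>+\<omega>. indicator {\<omega>\<in>space M. X n \<omega> = Y n \<omega>} \<omega> \<partial>M)"
    by (rule nn_integral_suminf) measurable
  also have "\<dots> = (\<Sum>n. ennreal (prob {\<omega>\<in>space M. X n \<omega> = Y n \<omega>}))"
    by (simp add: emeasure_eq_measure)
  finally show ?thesis .
qed

text \<open>
  Two independent variables that agree almost surely are deterministic: each value \<open>x\<close> has a probability
  with \<open>P(x) = P(x)\<^sup>2\<close>. This is how the common starting vertex emerges from the hypotheses.
\<close>
lemma (in prob_space) common_law_point_mass:
  fixes X Y :: "'a \<Rightarrow> 's::countable"
  assumes [measurable]: "X \<in> measurable M (count_space UNIV)" "Y \<in> measurable M (count_space UNIV)"
    and eq: "AE \<omega> in M. X \<omega> = Y \<omega>"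
    and indep: "\<And>x y. prob {\<omega>\<in>space M. X \<omega> = x \<and> Y \<omega> = y} = prob {\<omega>\<in>space M. X \<omega> = x} * prob {\<omega>\<in>space M. Y \<omega> = y}"
  obtains x0 where "\<And>x. prob {\<omega>\<in>space M. X \<omega> = x} = (if x = x0 then 1 else 0)"
    "\<And>x. prob {\<omega>\<in>space M. Y \<omega> = x} = (if x = x0 then 1 else 0)"
proof -
  let ?p = "\<lambda>x. prob {\<omega>\<in>space M. X \<omega> = x}"
  have Y: "prob {\<omega>\<in>space M. Y \<omega> = x} = ?p x" for x
    using eq by (intro finite_measure_eq_AE) auto
  have idem: "?p x * ?p x = ?p x * 1" for x
  proof -
    have "prob {\<omega>\<in>space M. X \<omega> = x \<and> Y \<omega> = x} = ?p x"
      using eq by (intro finite_measure_eq_AE) auto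
    then show ?thesis unfolding indep Y by simp
  qed
  have zero_one: "?p x = 0 \<or> ?p x = 1" for x
    using idem[of x] unfolding mult_cancel_left by blast
  have mf: "mass_function ?p"
    by (rule mass_function_law) measurable
  then have hs: "(?p has_sum 1) UNIV" by (simp add: mass_function_def)
  obtain x0 where x0: "?p x0 = 1"
  proof (cases "\<forall>x. ?p x = 0")
    case True
    then have "(?p has_sum 0) UNIV" by (simp add: has_sum_0)
    from has_sum_unique[OF hs this] show ?thesis by simp
  qed (use zero_one that in blast)
  have "?p x = 0" if "x \<noteq> x0" for x
    using mass_function_sum_le_1[OF mf, of "{x, x0}"] that zero_one[of x] x0 by auto
  with x0 have "?p x = (if x = x0 then 1 else 0)" for x by simp
  then show ?thesis using Y by (intro that) simp_all
qed

theorem theorem1p1: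
  fixes M :: "'a measure" and X Y :: "nat \<Rightarrow> 'a \<Rightarrow> int ^ 'd::finite"
  assumes "prob_space M"
    and "simple_random_walk M X"
    and "simple_random_walk M Y"
    and "indep_processes M X Y"
    and "AE \<omega> in M. X 0 \<omega> = Y 0 \<omega>"
  shows "(CARD('d) \<le> 2 \<longrightarrow> (\<integral>\<^sup>+\<omega>. num_collisions X Y \<omega> \<partial>M) = \<infinity>) \<and>
         (CARD('d) > 2 \<longrightarrow> (\<integral>\<^sup>+\<omega>. num_collisions X Y \<omega> \<partial>M) < \<infinity>)"
proof -
  interpret prob_space M by fact
  have [measurable]: "\<And>n. X n \<in> measurable M (count_space UNIV)" "\<And>n. Y n \<in> measurable M (count_space UNIV)"
    using assms by (auto simp: simple_random_walk_def markov_chain_def)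
  define p where "p = (\<lambda>n x. prob {\<omega>\<in>space M. X n \<omega> = x})"
  define q where "q = (\<lambda>n x. prob {\<omega>\<in>space M. Y n \<omega> = x})"
  define u where "u = (\<lambda>n. autocorr (p n) 0)"
  have pS: "p (Suc n) = walk_step unit_steps (p n)" and qS: "q (Suc n) = walk_step unit_steps (q n)" for n
    unfolding p_def q_def by (intro random_walk_law_Suc assms)+
  have mf: "mass_function (p n)" for n
    unfolding p_def by (rule mass_function_law) measurable
  obtain x0 where "\<And>x. p 0 x = (if x = x0 then 1 else 0)" "\<And>x. q 0 x = (if x = x0 then 1 else 0)"
    unfolding p_def q_def
    by (rule common_law_point_mass[of "X 0" "Y 0"])
      (use assms in \<open>auto simp: indep_processes_marginals\<close>)
  then have p0: "p 0 = (\<lambda>x. if x = x0 then 1 else 0)" and q0: "q 0 = p 0"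
    by (simp_all add: fun_eq_iff)
  have qp: "q n = p n" for n
    by (induction n) (simp_all add: q0 pS qS)
  have u: "prob {\<omega>\<in>space M. X n \<omega> = Y n \<omega>} = u n" for n
  proof -
    have "((\<lambda>x. prob {\<omega>\<in>space M. \<omega> \<in> {\<omega>\<in>space M. X n \<omega> = Y n \<omega>} \<and> X n \<omega> = x})
        has_sum prob {\<omega>\<in>space M. X n \<omega> = Y n \<omega>}) UNIV"
      by (rule prob_partition_has_sum) measurable
    moreover have "prob {\<omega>\<in>space M. \<omega> \<in> {\<omega>\<in>space M. X n \<omega> = Y n \<omega>} \<and> X n \<omega> = x} = p n x * p n x" for x
    proof -
      have "{\<omega>\<in>space M. \<omega> \<in> {\<omega>\<in>space M. X n \<omega> = Y n \<omega>} \<and> X n \<omega> = x} = {\<omega>\<in>space M. X n \<omega> = x \<and> Y n \<omega> = x}"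
        by auto
      then show ?thesis
        using fun_cong[OF qp[of n], of x] by (simp add: indep_processes_marginals[OF assms(4)] p_def q_def)
    qed
    ultimately show ?thesis
      using autocorr_has_sum[OF mf, of n 0 0] by (simp add: u_def has_sum_unique)
  qed
  have E: "(\<integral>\<^sup>+\<omega>. num_collisions X Y \<omega> \<partial>M) = (\<Sum>n. ennreal (u n))"
    by (simp add: nn_integral_num_collisions u)
  have u0: "0 \<le> u n" for n
    unfolding u_def by (rule autocorr_0_bounds[OF mf])
  show ?thesis
  proof (intro conjI impI)
    assume d: "CARD('d) \<le> 2"
    \<comment> \<open>For \<open>n = 0\<close> the bound is trivial, because \<open>inverse 0 = 0\<close>.\<close>
    have lower: "1 / 200 * inverse (real n) \<le> u n" for n
    proof (cases "n = 0")
      case False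
      then show ?thesis
        using walk_autocorr_0_lower_bound[OF p0 pS mf d, of n] by (simp add: u_def field_simps)
    qed (use u0 in simp)
    have "\<not> summable u"
    proof
      assume "summable u"
      then have "summable (\<lambda>n. 1 / 200 * inverse (real n))"
        by (rule summable_comparison_test_ev[rotated]) (use lower in \<open>auto intro!: always_eventually\<close>)
      then have "summable (\<lambda>n. inverse (real n))"
        by (subst (asm) summable_cmult_iff) auto
      then show False using not_summable_harmonic by blast
    qed
    then have "(\<Sum>n. ennreal (u n)) = top"
      using summable_suminf_not_top[of u] u0 by blast
    then show "(\<integral>\<^sup>+\<omega>. num_collisions X Y \<omega> \<partial>M) = \<infinity>"
      by (simp only: E infinity_ennreal_def)
  next
    assume d: "CARD('d) > 2"
    then obtain T where "T \<subseteq> (UNIV :: 'd set)" "card T = 3"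
      using obtain_subset_with_card_n[of 3 "UNIV :: 'd set"] by auto
    then obtain i1 i2 i3 :: 'd where i: "i1 \<noteq> i2" "i1 \<noteq> i3" "i2 \<noteq> i3"
      by (auto simp: card_3_iff)
    have "(\<Sum>k<n. u k) \<le> 540 * (real (card (unit_steps :: (int ^ 'd) set)))\<^sup>2" for n
      unfolding u_def
      by (rule walk_autocorr_0_sums_bounded[where p = p and a = "axis i1 1" and b = "axis i2 1" and c = "axis i3 1", OF mf pS finite_unit_steps _ _ _ _ _ _ inj_coordinate_box[OF i]])
        (rule axis_in_unit_steps)+
    then have "summable u"
      using u0 by (intro summableI_nonneg_bounded)
    then show "(\<integral>\<^sup>+\<omega>. num_collisions X Y \<omega> \<partial>M) < \<infinity>"
      unfolding E infinity_ennreal_def less_top[symmetric] using u0 by (rule ennreal_suminf_neq_top)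
  qed
qed

end
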